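(* Let $\lambda \in (0,\frac14)$, $x_* = \frac{1-\sqrt{1-4\lambda}}{2}$, $I_\lambda = \left(x_*, \frac{1+\sqrt{1-4\lambda}}{2}\right)$, and $\vec z \in I_\lambda \times (0,1)$. Let $T$ be a finite or countably infinite subset of $(x_*, \vec z_1) \times (0,1)$ such that for every $\vec v \in T \setminus \mathcal{A}(\vec z)$, the point $\mathit{Dec}(\vec v)$ is a convex combination of elements of $T$. Then $T \subseteq \mathcal{A}(\vec z)$.
   Context: For $\vec u \in \mathbb{R}^2$, $\vec u_1,\vec u_2$ denote its components. $\mathit{Inc}(\vec v) = \left(\frac{\lambda}{1-\vec v_1}, \frac{\vec v_2\,\lambda}{1-\vec v_1}\right)$, $\mathit{Dec}(\vec v) = \left(\frac{\vec v_1-\lambda}{\vec v_1}, \frac{\vec v_2}{\vec v_1}\right)$, and $\mathit{Inc}^n$ is the $n$-fold composition of $\mathit{Inc}$. The points $\mathit{Inc}^n(\vec z)$, $n \in \mathbb{N}$, have strictly decreasing first coordinates converging to $x_*$ and second coordinates converging to $0$. $\mathcal{A}(\vec z)$ is the closed convex region bounded by the vertical lines $x = x_*$ and $x = \vec z_1$, the horizontal line $y = 1$, and the polygonal chain consisting of the line segments between consecutive points $\mathit{Inc}^n(\vec z)$ and $\mathit{Inc}^{n+1}(\vec z)$ ($n \in \mathbb{N}$), ending at $(x_*,0)$; i.e. $\mathcal{A}(\vec z) = \{(x,y) : x_* \leq x \leq \vec z_1,\ g(x) \leq y \leq 1\}$ where $g$ is the piecewise-linear function on $[x_*,\vec z_1]$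 with $g(\mathit{Inc}^n(\vec z)_1) = \mathit{Inc}^n(\vec z)_2$ for all $n$, linear on each interval $[\mathit{Inc}^{n+1}(\vec z)_1, \mathit{Inc}^n(\vec z)_1]$, and $g(x_* ) = 0$. *)

theory Defs
  imports "HOL-Analysis.Analysis"
begin

definition Inc :: "real \<Rightarrow> real \<times> real \<Rightarrow> real \<times> real" where
  "Inc lam v = (lam / (1 - fst v), snd v * lam / (1 - fst v))"

definition Dec :: "real \<Rightarrow> real \<times> real \<Rightarrow> real \<times> real" where
  "Dec lam v = ((fst v - lam) / fst v, snd v / fst v)"

definition xstar :: "real \<Rightarrow> real" where
  "xstar lam = (1 - sqrt (1 - 4 * lam)) / 2"

definition I_lam :: "real \<Rightarrow> real set" where
  "I_lam lam = {xstar lam <..< (1 + sqrt (1 - 4 * lam)) / 2}"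

text \<open>
  The piecewise-linear function through the points \<open>(Inc lam ^^ n) z\<close>. The first coordinates of
  these points decrease strictly to \<open>xstar lam\<close>, so for \<open>xstar lam < x \<le> fst z\<close> the least \<open>n\<close> below
  is the index of the interval containing \<open>x\<close>. The lemmas \<open>chain_fun_xstar\<close>, \<open>chain_fun_Inc\<close> and
  \<open>chain_fun_linear\<close> state the properties that characterise the function on
  \<open>{xstar lam..fst z}\<close>.
\<close>

definition chain_fun :: "real \<Rightarrow> real \<times> real \<Rightarrow> real \<Rightarrow> real" where
  "chain_fun lam z x =
    (if x \<le> xstar lam then 0
     else let n = (LEAST n. fst ((Inc lam ^^ Suc n) z) \<le> x);
              p = (Inc lam ^^ Suc n) z;
              q = (Inc lam ^^ n) z
          in snd p + (x - fst p) / (fst q - fst p) * (snd q - snd p))"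

definition region_A :: "real \<Rightarrow> real \<times> real \<Rightarrow> (real \<times> real) set" where
  "region_A lam z =
    {(x, y). xstar lam \<le> x \<and> x \<le> fst z \<and> chain_fun lam z x \<le> y \<and> y \<le> 1}"

lemma I_lam_step:
  assumes "0 < lam" "lam < 1/4" "x \<in> I_lam lam"
  shows "lam / (1 - x) < x" "lam / (1 - x) \<in> I_lam lam"
proof -
  define s where "s = sqrt (1 - 4 * lam)"
  have s0: "s > 0" and s2: "s * s = 1 - 4 * lam" using assms by (auto simp: s_def)
  have "s * s < 1 * 1" using s2 assms by simp
  then have s1: "s < 1" using s0
    by (metis mult_strict_mono not_less_iff_gr_or_eq zero_less_one less_eq_real_def)
  have x: "(1 - s) / 2 < x" "x < (1 + s) / 2"
    using assms(3) by (auto simp: I_lam_def xstar_def s_def)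
  have x1: "x < 1" using x s1 by simp
  have "(x - (1 - s) / 2) * ((1 + s) / 2 - x) > 0" using x by simp
  moreover have "(x - (1 - s) / 2) * ((1 + s) / 2 - x) = x - x * x - (1 - s * s) / 4"
    by (simp add: field_simps)
  ultimately have "lam < x * (1 - x)" using s2 by (simp add: algebra_simps)
  then show lt: "lam / (1 - x) < x" using x1 by (simp add: pos_divide_less_eq)
  have "lam = (1 - s) / 2 * ((1 + s) / 2)" using s2 by (simp add: field_simps)
  moreover have "(1 - s) / 2 * (1 - x) < (1 - s) / 2 * ((1 + s) / 2)"
    by (rule mult_strict_left_mono) (use x s1 in \<open>simp_all add: field_simps\<close>)
  ultimately have "(1 - s) / 2 < lam / (1 - x)" using x1 by (simp add: pos_less_divide_eq)
  moreover have "lam / (1 - x) < (1 + s) / 2" using lt x(2) by (rule less_trans)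
  ultimately show "lam / (1 - x) \<in> I_lam lam"
    unfolding I_lam_def xstar_def s_def greaterThanLessThan_iff by blast
qed

lemma Inc_pow_fst_in_I_lam:
  assumes "0 < lam" "lam < 1/4" "fst z \<in> I_lam lam"
  shows "fst ((Inc lam ^^ n) z) \<in> I_lam lam"
  by (induction n) (use assms I_lam_step(2) in \<open>auto simp: Inc_def\<close>)

lemma Inc_pow_fst_strict_decreasing:
  assumes "0 < lam" "lam < 1/4" "fst z \<in> I_lam lam"
  shows "fst ((Inc lam ^^ Suc n) z) < fst ((Inc lam ^^ n) z)"
  using I_lam_step(1)[OF assms(1,2) Inc_pow_fst_in_I_lam[OF assms, of n]]
  by (simp add: Inc_def)

lemma Inc_pow_fst_decseq:
  assumes "0 < lam" "lam < 1/4" "fst z \<in> I_lam lam"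
  shows "decseq (\<lambda>n. fst ((Inc lam ^^ n) z))"
  by (rule decseq_SucI) (use Inc_pow_fst_strict_decreasing[OF assms] in \<open>auto intro: less_imp_le\<close>)

lemma Inc_pow_fst_tendsto:
  assumes "0 < lam" "lam < 1/4" "fst z \<in> I_lam lam"
  shows "(\<lambda>n. fst ((Inc lam ^^ n) z)) \<longlonglongrightarrow> xstar lam"
proof -
  let ?X = "\<lambda>n. fst ((Inc lam ^^ n) z)"
  define s where "s = sqrt (1 - 4 * lam)"
  have s0: "s > 0" and s2: "s * s = 1 - 4 * lam" using assms by (auto simp: s_def)
  have inI: "xstar lam < ?X n" "?X n < (1 + s) / 2" for n
    using Inc_pow_fst_in_I_lam[OF assms, of n] by (auto simp: I_lam_def s_def)
  obtain L where L: "?X \<longlonglongrightarrow> L" "\<And>n. L \<le> ?X n"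
    using decseq_convergent[OF Inc_pow_fst_decseq[OF assms], of "xstar lam"] inI
    by (metis less_imp_le)
  have L1: "xstar lam \<le> L" by (rule LIMSEQ_le_const[OF L(1)]) (use inI in \<open>auto intro: less_imp_le\<close>)
  have L2: "L < (1 + s) / 2" using L(2)[of 0] inI(2)[of 0] by simp
  have "s * s < 1 * 1" using s2 assms by simp
  then have "s < 1" using s0
    by (metis mult_strict_mono not_less_iff_gr_or_eq zero_less_one less_eq_real_def)
  then have "1 - L \<noteq> 0" using L2 by simp
  then have "(\<lambda>n. lam / (1 - ?X n)) \<longlonglongrightarrow> lam / (1 - L)"
    by (intro tendsto_intros L(1))
  then have "(\<lambda>n. ?X (Suc n)) \<longlonglongrightarrow> lam / (1 - L)" by (simp add: Inc_def)
  moreover have "(\<lambda>n. ?X (Suc n)) \<longlonglongrightarrow> L" by (rule LIMSEQ_Suc[OF L(1)])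
  ultimately have "lam / (1 - L) = L" by (rule LIMSEQ_unique)
  then have "lam = L * (1 - L)" using \<open>1 - L \<noteq> 0\<close> by (simp add: field_simps)
  moreover have "(L - (1 - s) / 2) * ((1 + s) / 2 - L) = L * (1 - L) - (1 - s * s) / 4"
    by (simp add: field_simps)
  ultimately have "(L - (1 - s) / 2) * ((1 + s) / 2 - L) = 0" using s2 by simp
  then have "L = xstar lam" using L2 by (auto simp: xstar_def s_def)
  then show ?thesis using L(1) by simp
qed

lemma Inc_pow_interval_exists:
  assumes "0 < lam" "lam < 1/4" "fst z \<in> I_lam lam" "xstar lam < x" "x \<le> fst z"
  shows "\<exists>n. x \<in> {fst ((Inc lam ^^ Suc n) z)..fst ((Inc lam ^^ n) z)}"
proof -
  let ?X = "\<lambda>n. fst ((Inc lam ^^ n) z)"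
  have "\<forall>\<^sub>F n in sequentially. ?X n < x"
    using order_tendstoD(2)[OF Inc_pow_fst_tendsto[OF assms(1-3)] assms(4)] .
  then obtain n where n: "?X n < x" by (auto simp: eventually_sequentially)
  define m where "m = (LEAST n. ?X n < x)"
  have m: "?X m < x" unfolding m_def by (rule LeastI[of "\<lambda>n. ?X n < x", OF n])
  then have "m \<noteq> 0" using assms(5) by (cases m) auto
  then obtain k where k: "m = Suc k" by (cases m) auto
  have "\<not> ?X k < x" using not_less_Least[of k "\<lambda>n. ?X n < x"] k by (simp add: m_def)
  then show ?thesis using m k by (intro exI[of _ k]) auto
qed

lemma chain_fun_xstar: "chain_fun lam z (xstar lam) = 0"
  by (simp add: chain_fun_def)

lemma chain_fun_linear:
  assumes "0 < lam" "lam < 1/4" "fst z \<in> I_lam lam"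
    and x: "x \<in> {fst ((Inc lam ^^ Suc n) z)..fst ((Inc lam ^^ n) z)}"
  defines "p \<equiv> (Inc lam ^^ Suc n) z" and "q \<equiv> (Inc lam ^^ n) z"
  shows "chain_fun lam z x = snd p + (x - fst p) / (fst q - fst p) * (snd q - snd p)"
proof -
  let ?P = "\<lambda>n. (Inc lam ^^ n) z"
  let ?m = "LEAST n. fst (?P (Suc n)) \<le> x"
  have xs: "\<not> x \<le> xstar lam"
    using x Inc_pow_fst_in_I_lam[OF assms(1-3), of "Suc n"] by (auto simp: I_lam_def)
  have Px: "fst (?P (Suc n)) \<le> x" using x by simp
  have m: "fst (?P (Suc ?m)) \<le> x" by (rule LeastI[of "\<lambda>n. fst (?P (Suc n)) \<le> x", OF Px])
  have mn: "?m \<le> n" by (rule Least_le[of "\<lambda>n. fst (?P (Suc n)) \<le> x", OF Px])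
  have eq: "chain_fun lam z x = snd (?P (Suc ?m)) + (x - fst (?P (Suc ?m))) /
      (fst (?P ?m) - fst (?P (Suc ?m))) * (snd (?P ?m) - snd (?P (Suc ?m)))"
    using xs unfolding chain_fun_def Let_def by (simp only: if_False)
  show ?thesis
  proof (cases "?m = n")
    case True
    show ?thesis using eq unfolding True p_def q_def .
  next
    case False
    then have "Suc ?m \<le> n" using mn by simp
    then have "fst (?P n) \<le> fst (?P (Suc ?m))"
      using Inc_pow_fst_decseq[OF assms(1-3)] by (auto simp: decseq_def simp del: funpow.simps)
    then have xq: "x = fst q" and xm: "fst (?P (Suc ?m)) = fst (?P n)"
      using m x unfolding q_def by auto
    have "Suc ?m = n"
    proof (rule ccontr)
      assume "Suc ?m \<noteq> n"
      then have "Suc (Suc ?m) \<le> n" using \<open>Suc ?m \<le> n\<close> by simp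
      then have "fst (?P n) \<le> fst (?P (Suc (Suc ?m)))"
        using Inc_pow_fst_decseq[OF assms(1-3)] by (auto simp: decseq_def simp del: funpow.simps)
      then show False
        using Inc_pow_fst_strict_decreasing[OF assms(1-3), of "Suc ?m"] xm by linarith
    qed
    then have "chain_fun lam z x = snd q"
      using eq xq by (simp only: q_def) simp
    moreover have "fst q - fst p \<noteq> 0"
      using Inc_pow_fst_strict_decreasing[OF assms(1-3), of n] unfolding p_def q_def by linarith
    ultimately show ?thesis using xq by simp
  qed
qed

lemma chain_fun_Inc:
  assumes "0 < lam" "lam < 1/4" "fst z \<in> I_lam lam"
  shows "chain_fun lam z (fst ((Inc lam ^^ n) z)) = snd ((Inc lam ^^ n) z)"
proof -
  have lt: "fst ((Inc lam ^^ Suc n) z) < fst ((Inc lam ^^ n) z)"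
    by (rule Inc_pow_fst_strict_decreasing[OF assms])
  then have "fst ((Inc lam ^^ n) z) \<in> {fst ((Inc lam ^^ Suc n) z)..fst ((Inc lam ^^ n) z)}"
    by simp
  from chain_fun_linear[OF assms this] lt show ?thesis by (simp del: funpow.simps)
qed

end

theory Submission
  imports Defs
begin

text \<open>
  Let \<open>a = xstar lam\<close>. The fixed points of \<open>Dec\<close> on the first coordinate are \<open>a\<close> and \<open>1 - a\<close>, and in
  the homogeneous coordinates \<open>1 - a - x\<close>, \<open>x - a\<close>, \<open>y\<close> the projective map \<open>Dec\<close> is diagonal with
  entries \<open>a\<close>, \<open>1 - a\<close>, \<open>1\<close>. Hence the line through \<open>Inc\<^sup>n z\<close> and \<open>Inc\<^sup>n\<^sup>+\<^sup>1 z\<close> is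
  \<open>y = chain_line (n + 2) x\<close> for an explicit sequence of affine functions, and \<open>Dec\<close> carries the
  points below line \<open>i + 1\<close> to the points below line \<open>i\<close>. Since line \<open>i + 2\<close> minus line \<open>i + 1\<close> is
  \<open>- lam\<close> times line \<open>i\<close>, which changes sign at \<open>Inc\<^sup>i z\<close>, the chain is the upper envelope of the lines
  \<open>i \<ge> 1\<close> on \<open>x \<le> fst z\<close>. So a point of \<open>T\<close> below line \<open>i + 1\<close> is outside the region, its image
  under \<open>Dec\<close> is a convex combination of points of \<open>T\<close>, and one of these is below line \<open>i\<close>. The
  descent ends at line \<open>0\<close>, which increases to the value \<open>0\<close> at \<open>x = fst z\<close>; no point of \<open>T\<close> is
  below it.
\<close>

lemma unimodal_le_peak:
  fixes f :: "nat \<Rightarrow> 'a::preorder"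
  assumes up: "\<And>i. i < n \<Longrightarrow> f i \<le> f (Suc i)"
    and down: "\<And>i. n \<le> i \<Longrightarrow> f (Suc i) \<le> f i"
  shows "f i \<le> f n"
proof (cases "i \<le> n")
  case True
  then show ?thesis
    by (induction i rule: inc_induct) (auto intro: up order_trans)
next
  case False
  then have "n \<le> i" by simp
  then show ?thesis
    by (induction i rule: dec_induct) (auto intro: down order_trans)
qed

lemma subset_convex_if_image_in_hull:
  fixes H :: "nat \<Rightarrow> 'a::real_vector set"
  assumes "T \<subseteq> H 0" and "\<And>i. convex (H i)"
    and hull: "\<And>i v. v \<in> T - H (Suc i) \<Longrightarrow> D v \<in> convex hull T"
    and pull_back: "\<And>i v. v \<in> T \<Longrightarrow> D v \<in> H i \<Longrightarrow> v \<in> H (Suc i)"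
  shows "T \<subseteq> H i"
proof (induction i)
  case 0
  show ?case by fact
next
  case (Suc i)
  then have "convex hull T \<subseteq> H i" using assms(2) by (rule hull_minimal)
  then show ?case using hull pull_back by blast
qed

lemma xstar_pos_iff: "0 < xstar lam \<longleftrightarrow> 0 < lam"
  by (simp add: xstar_def)

lemma xstar_less_half_iff: "xstar lam < 1/2 \<longleftrightarrow> lam < 1/4"
  by (auto simp: xstar_def)

lemma xstar_root:
  assumes "lam \<le> 1/4"
  shows "xstar lam * (1 - xstar lam) = lam"
proof -
  have "xstar lam * (1 - xstar lam) = (1 - (sqrt (1 - 4 * lam))\<^sup>2) / 4"
    by (simp add: xstar_def field_simps power2_eq_square)
  then show ?thesis using assms by simp
qed

lemma I_lam_eq: "I_lam lam = {xstar lam<..<1 - xstar lam}"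
  by (auto simp: I_lam_def xstar_def field_simps)

lemma Dec_Inc:
  assumes "lam \<noteq> 0" "fst v \<noteq> 1"
  shows "Dec lam (Inc lam v) = v"
  using assms by (auto simp: Dec_def Inc_def field_simps intro!: prod_eqI)

definition Dec_line :: "'a::comm_ring_1 \<Rightarrow> 'a \<Rightarrow> 'a \<Rightarrow> nat \<Rightarrow> 'a \<Rightarrow> 'a" where
  "Dec_line a p q i x = q * (1 - a) ^ i * (x - a) - p * a ^ i * (1 - a - x)"

lemma Dec_line_Suc_Suc:
  "Dec_line a p q (Suc (Suc i)) x = Dec_line a p q (Suc i) x - a * (1 - a) * Dec_line a p q i x"
  by (simp add: Dec_line_def algebra_simps)

lemma Dec_line_Dec:
  assumes "fst v \<noteq> 0"
  shows "Dec_line a p q i (fst (Dec (a * (1 - a)) v)) = Dec_line a p q (Suc i) (fst v) / fst v"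
proof -
  have "fst (Dec (a * (1 - a)) v) - a = (1 - a) * (fst v - a) / fst v"
    "1 - a - fst (Dec (a * (1 - a)) v) = a * (1 - a - fst v) / fst v"
    using assms by (simp_all add: Dec_def field_simps)
  then show ?thesis by (simp add: Dec_line_def diff_divide_distrib mult_ac)
qed

lemma Dec_line_affine:
  assumes "u + v = 1"
  shows "Dec_line a p q i (u * x + v * y) = u * Dec_line a p q i x + v * Dec_line a p q i y"
proof -
  have "v = 1 - u" using assms by (simp add: algebra_simps)
  then show ?thesis by (simp only: Dec_line_def) (simp add: algebra_simps)
qed

lemma convex_on_Dec_line: "convex_on UNIV (Dec_line a p q i)"
  by (rule convex_onI) (simp_all add: Dec_line_affine)

lemma mono_Dec_line:
  fixes a p q :: "'a::linordered_idom"
  assumes "0 \<le> a" "a \<le> 1" "0 \<le> p" "0 \<le> q"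
  shows "mono (Dec_line a p q i)"
  using assms by (auto simp: Dec_line_def intro!: monoI diff_mono mult_left_mono)

locale Inc_chain =
  fixes lam :: real and z :: "real \<times> real"
  assumes admissible: "0 < lam" "lam < 1/4" "fst z \<in> I_lam lam"
    and snd_z_nonneg: "0 \<le> snd z"
begin

abbreviation vertex :: "nat \<Rightarrow> real \<times> real" where
  "vertex n \<equiv> (Inc lam ^^ n) z"

text \<open>The coefficients make line \<open>0\<close> vanish and line \<open>1\<close> take the value \<open>snd z\<close> at \<open>fst z\<close>.\<close>

definition xstar_coeff :: real where
  "xstar_coeff = snd z / ((1 - 2 * xstar lam) * (1 - xstar lam - fst z))"

definition one_minus_xstar_coeff :: real where
  "one_minus_xstar_coeff = snd z / ((1 - 2 * xstar lam) * (fst z - xstar lam))"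

abbreviation chain_line :: "nat \<Rightarrow> real \<Rightarrow> real" where
  "chain_line \<equiv> Dec_line (xstar lam) xstar_coeff one_minus_xstar_coeff"

lemma xstar_in: "xstar lam \<in> {0<..<1/2}"
  using admissible xstar_pos_iff xstar_less_half_iff by simp

lemma fst_z_in: "fst z \<in> {xstar lam<..<1 - xstar lam}"
  using admissible(3) by (simp add: I_lam_eq)

lemma xstar_times: "xstar lam * (1 - xstar lam) = lam"
  using admissible(2) by (intro xstar_root) simp

lemma mono_chain_line: "mono (chain_line i)"
  using xstar_in fst_z_in snd_z_nonneg
  by (intro mono_Dec_line) (auto simp: xstar_coeff_def one_minus_xstar_coeff_def)

lemma chain_line_Suc_Suc:
  "chain_line (Suc (Suc i)) x = chain_line (Suc i) x - lam * chain_line i x"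
  by (simp add: Dec_line_Suc_Suc xstar_times)

lemma chain_line_Dec:
  assumes "fst v \<noteq> 0"
  shows "chain_line i (fst (Dec lam v)) = chain_line (Suc i) (fst v) / fst v"
  using Dec_line_Dec[OF assms, of "xstar lam"] by (simp add: xstar_times)

lemma vertex_in_I_lam: "fst (vertex n) \<in> I_lam lam"
  using admissible by (rule Inc_pow_fst_in_I_lam)

lemma chain_line_vertex_Suc:
  "chain_line (Suc i) (fst (vertex (Suc n))) = fst (vertex (Suc n)) * chain_line i (fst (vertex n))"
proof -
  have "fst (vertex (Suc n)) \<noteq> 0" "fst (vertex n) \<noteq> 1"
    using vertex_in_I_lam[of "Suc n"] vertex_in_I_lam[of n] xstar_in
    unfolding I_lam_eq by auto
  moreover from this have "Dec lam (vertex (Suc n)) = vertex n"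
    using admissible(1) by (simp add: Dec_Inc)
  ultimately show ?thesis
    using chain_line_Dec[of "vertex (Suc n)" i] by (simp del: funpow.simps)
qed

lemma snd_vertex_Suc: "snd (vertex (Suc n)) = fst (vertex (Suc n)) * snd (vertex n)"
  by (simp add: Inc_def)

lemma chain_line_at_z: "chain_line 0 (fst z) = 0" "chain_line 1 (fst z) = snd z"
proof -
  define r where "r = snd z / (1 - 2 * xstar lam)"
  have products: "one_minus_xstar_coeff * (fst z - xstar lam) = r"
    "xstar_coeff * (1 - xstar lam - fst z) = r"
    using fst_z_in by (simp_all add: one_minus_xstar_coeff_def xstar_coeff_def r_def)
  then show "chain_line 0 (fst z) = 0" by (simp add: Dec_line_def)
  have "chain_line 1 (fst z) = (1 - xstar lam) * (one_minus_xstar_coeff * (fst z - xstar lam)) -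
      xstar lam * (xstar_coeff * (1 - xstar lam - fst z))"
    by (simp add: Dec_line_def mult_ac)
  also have "\<dots> = (1 - 2 * xstar lam) * r"
    unfolding products by (simp add: algebra_simps)
  also have "\<dots> = snd z" using xstar_in by (simp add: r_def)
  finally show "chain_line 1 (fst z) = snd z" .
qed

lemma
  shows chain_line_vertex_zero: "chain_line n (fst (vertex n)) = 0"
    and chain_line_vertex_right: "chain_line (Suc n) (fst (vertex n)) = snd (vertex n)"
    and chain_line_vertex_left: "chain_line (Suc (Suc n)) (fst (vertex n)) = snd (vertex n)"
proof -
  show zero: "chain_line n (fst (vertex n)) = 0"
  proof (induction n)
    case (Suc n)
    then show ?case by (simp only: chain_line_vertex_Suc mult_zero_right)
  qed (simp add: chain_line_at_z)
  show right: "chain_line (Suc n) (fst (vertex n)) = snd (vertex n)"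
  proof (induction n)
    case (Suc n)
    then show ?case by (simp only: chain_line_vertex_Suc snd_vertex_Suc)
  qed (use chain_line_at_z in simp)
  show "chain_line (Suc (Suc n)) (fst (vertex n)) = snd (vertex n)"
    by (simp add: chain_line_Suc_Suc zero right del: funpow.simps)
qed

lemma chain_fun_eq_chain_line:
  assumes x: "x \<in> {fst (vertex (Suc n))..fst (vertex n)}"
  shows "chain_fun lam z x = chain_line (Suc (Suc n)) x"
proof -
  define p q where "p = vertex (Suc n)" and "q = vertex n"
  define t where "t = (x - fst p) / (fst q - fst p)"
  have "fst p < fst q"
    using Inc_pow_fst_strict_decreasing[OF admissible] unfolding p_def q_def .
  then have "t * (fst q - fst p) = x - fst p" by (simp add: t_def)
  then have "x = t * fst q + (1 - t) * fst p" by (simp add: algebra_simps)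
  then have "chain_line (Suc (Suc n)) x = t * snd q + (1 - t) * snd p"
    by (simp only: Dec_line_affine p_def q_def chain_line_vertex_left chain_line_vertex_right)
  also have "\<dots> = snd p + t * (snd q - snd p)" by (simp add: algebra_simps)
  also have "\<dots> = chain_fun lam z x"
    using chain_fun_linear[OF admissible x] unfolding p_def q_def t_def by simp
  finally show ?thesis by simp
qed

lemma chain_line_Suc_le_peak:
  assumes x: "x \<in> {fst (vertex (Suc n))..fst (vertex n)}"
  shows "chain_line (Suc i) x \<le> chain_line (Suc (Suc n)) x"
proof (rule unimodal_le_peak[where f = "\<lambda>i. chain_line (Suc i) x"])
  note vertex_antimono = decseqD[OF Inc_pow_fst_decseq[OF admissible]]
  fix i
  show "chain_line (Suc i) x \<le> chain_line (Suc (Suc i)) x" if "i < Suc n"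
  proof -
    have "x \<le> fst (vertex i)" using x vertex_antimono[of i n] that by simp
    then have "chain_line i x \<le> 0"
      using monoD[OF mono_chain_line] by (metis chain_line_vertex_zero)
    then show ?thesis
      using admissible(1) by (simp add: chain_line_Suc_Suc mult_le_0_iff)
  qed
  show "chain_line (Suc (Suc i)) x \<le> chain_line (Suc i) x" if "Suc n \<le> i"
  proof -
    have "fst (vertex i) \<le> x" using x vertex_antimono[OF that] by simp
    then have "0 \<le> chain_line i x"
      using monoD[OF mono_chain_line] by (metis chain_line_vertex_zero)
    then show ?thesis
      using admissible(1) by (simp add: chain_line_Suc_Suc)
  qed
qed

lemma chain_fun_le_iff:
  assumes "xstar lam < x" "x \<le> fst z"
  shows "chain_fun lam z x \<le> y \<longleftrightarrow> (\<forall>i. chain_line (Suc i) x \<le> y)"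
proof -
  obtain n where n: "x \<in> {fst (vertex (Suc n))..fst (vertex n)}"
    using Inc_pow_interval_exists[OF admissible assms] by blast
  show ?thesis
    unfolding chain_fun_eq_chain_line[OF n]
    using chain_line_Suc_le_peak[OF n] by (meson order_trans)
qed

lemma in_region_A_iff:
  assumes "v \<in> {xstar lam<..fst z} \<times> {..1}"
  shows "v \<in> region_A lam z \<longleftrightarrow> (\<forall>i. v \<in> epigraph UNIV (chain_line (Suc i)))"
  using assms by (auto simp: region_A_def epigraph_def chain_fun_le_iff)

lemma in_epigraph_chain_line_Dec_iff:
  assumes "0 < fst v"
  shows "Dec lam v \<in> epigraph UNIV (chain_line i) \<longleftrightarrow> v \<in> epigraph UNIV (chain_line (Suc i))"
proof -
  have "snd (Dec lam v) = snd v / fst v" by (simp add: Dec_def)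
  then show ?thesis
    using assms by (simp add: epigraph_def chain_line_Dec divide_le_cancel)
qed

lemma in_epigraph_chain_line_0:
  assumes "fst v \<le> fst z" "0 \<le> snd v"
  shows "v \<in> epigraph UNIV (chain_line 0)"
  using monoD[OF mono_chain_line assms(1), of 0] assms(2)
  by (simp add: epigraph_def chain_line_at_z)

end

theorem theorem1:
  fixes lam :: real and z :: "real \<times> real" and T :: "(real \<times> real) set"
  assumes "0 < lam" and "lam < 1 / 4"
    and "z \<in> I_lam lam \<times> {0<..<1}"
    and "countable T"
    and "T \<subseteq> {xstar lam<..<fst z} \<times> {0<..<1}"
    and "\<forall>v \<in> T - region_A lam z. Dec lam v \<in> convex hull T"
  shows "T \<subseteq> region_A lam z"
proof -
  interpret Inc_chain lam z by unfold_locales (use assms in auto)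
  let ?H = "\<lambda>i. epigraph UNIV (chain_line i)"
  have strip: "v \<in> {xstar lam<..fst z} \<times> {..1}" if "v \<in> T" for v
    using assms(5) that by force
  have "T \<subseteq> ?H i" for i
  proof (rule subset_convex_if_image_in_hull[where D = "Dec lam"])
    show "T \<subseteq> ?H 0" using assms(5) by (force intro: in_epigraph_chain_line_0)
    show "convex (?H i)" for i by (simp add: convex_epigraph convex_on_Dec_line)
    show "Dec lam v \<in> convex hull T" if "v \<in> T - ?H (Suc i)" for i v
      using assms(6) that in_region_A_iff[OF strip] by blast
    show "v \<in> ?H (Suc i)" if "v \<in> T" "Dec lam v \<in> ?H i" for i v
      using that strip[of v] xstar_in by (auto simp: in_epigraph_chain_line_Dec_iff)
  qed
  then show ?thesis using in_region_A_iff[OF strip] by blast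
qed

end
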